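(* Let $m>0$, $0<\alpha\le\beta$, $T\ge2$. Let the hitting costs $f_t:\mathbb{R}^d\to[0,\infty)$ be $m$-strongly convex with minimizer $v_t$, and let the switching cost be $D_h(x_t\|x_{t-1})$, where $h:\mathbb{R}^d\to\mathbb{R}$ is $\alpha$-strongly convex and $\beta$-smooth. Let ALG be any online algorithm that can be expressed in the form $$x_t=\arg\min_{x}\; f_t(x)+D_h(x\|x_{t-1})+D_{g_t}(x\|v_t)\qquad\text{for all }t,$$ where $g_t$ is $\alpha'_t$-strongly convex and $\beta'_t$-smooth with $0\le\alpha'_t\le\beta'_t$. Then its competitive ratio in the adversarial setting satisfies $$\mathrm{CR}_{\mathrm{ALG}}\le1+\max\left\{\frac{\max_t\beta'_t}{m},\ \frac{\beta^2/\alpha}{\min_t\alpha'_{t-1}+m}\right\},$$ where the maximum is over $t\in\{1,\dots,T\}$ and the minimum is over $t\in\{2,\dots,T\}$.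
   Context: The Bregman divergence with respect to $h$ is $D_h(y\|x)=h(y)-h(x)-\langle\nabla h(x),y-x\rangle$. A (differentiable) function $h$ is $\alpha$-strongly convex and $\beta$-smooth iff $\frac{\alpha}{2}\|y-x\|_2^2\le D_h(y\|x)\le\frac{\beta}{2}\|y-x\|_2^2$ for all $x,y$. Starting from a given $x_0\in\mathbb{R}^d$, in each round $t$ the function $f_t$ (arbitrary, adversarially chosen) and its minimizer $v_t$ are revealed and the player picks $x_t$; the total cost is $\mathrm{Cost}[1,T]=\sum_{t=1}^T\left(f_t(x_t)+D_h(x_t\|x_{t-1})\right)$. $\mathrm{Cost}_{\mathrm{OPT}}[1,T]$ is the minimum cost over all sequences $(x_1,\dots,x_T)$ chosen in hindsight, with the same $x_0$. $\mathrm{CR}_{\mathrm{ALG}}\le\rho$ means $\mathrm{Cost}_{\mathrm{ALG}}[1,T]\le\rho\,\mathrm{Cost}_{\mathrm{OPT}}[1,T]$ for every instance. *)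

theory Defs
  imports "HOL-Analysis.Analysis"
begin

text \<open>Only meaningful where \<open>h\<close> is differentiable; see \<open>GDERIV_gradient\<close>.\<close>

definition gradient :: "('a::euclidean_space \<Rightarrow> real) \<Rightarrow> 'a \<Rightarrow> 'a" where
  "gradient h x = (THE D. GDERIV h x :> D)"

lemma GDERIV_gradient:
  fixes h :: "'a::euclidean_space \<Rightarrow> real"
  assumes "h differentiable (at x)"
  shows "GDERIV h x :> gradient h x"
proof -
  obtain h' where h': "(h has_derivative h') (at x)"
    using assms unfolding differentiable_def by blast
  then have "h' = (\<lambda>v. v \<bullet> (adjoint h' 1))"
    using adjoint_works[OF has_derivative_linear[OF h'], of _ "1::real"] by auto
  then have ex: "GDERIV h x :> adjoint h' 1"
    using h' unfolding gderiv_def by metis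
  have "D = adjoint h' 1" if "GDERIV h x :> D" for D
  proof -
    have "(\<lambda>v. v \<bullet> D) = (\<lambda>v. v \<bullet> adjoint h' 1)"
      using has_derivative_unique that ex unfolding gderiv_def by blast
    then show ?thesis by (metis vector_eq_ldot)
  qed
  with ex show ?thesis unfolding gradient_def by (metis theI)
qed

definition bregman :: "('a::euclidean_space \<Rightarrow> real) \<Rightarrow> 'a \<Rightarrow> 'a \<Rightarrow> real" where
  "bregman h y x = h y - h x - gradient h x \<bullet> (y - x)"

definition strongly_convex_smooth :: "real \<Rightarrow> real \<Rightarrow> ('a::euclidean_space \<Rightarrow> real) \<Rightarrow> bool" where
  "strongly_convex_smooth a b h \<longleftrightarrow>
     (\<forall>x. h differentiable (at x)) \<and>
     (\<forall>x y. a / 2 * (norm (y - x))\<^sup>2 \<le> bregman h y x \<and>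
            bregman h y x \<le> b / 2 * (norm (y - x))\<^sup>2)"

text \<open>Hitting costs are not required to be differentiable, so strong convexity is stated without
  a gradient. For differentiable functions it is the lower Bregman bound above; see
  \<open>strongly_convex_iff_bregman\<close>.\<close>

definition strongly_convex :: "real \<Rightarrow> ('a::euclidean_space \<Rightarrow> real) \<Rightarrow> bool" where
  "strongly_convex m f \<longleftrightarrow>
     (\<forall>x y. \<forall>u\<in>{0..1}. f ((1 - u) *\<^sub>R x + u *\<^sub>R y)
        \<le> (1 - u) * f x + u * f y - m / 2 * u * (1 - u) * (norm (x - y))\<^sup>2)"

lemma strongly_convex_iff_bregman:
  fixes f :: "'a::euclidean_space \<Rightarrow> real"
  assumes diff: "\<And>x. f differentiable (at x)"
  shows "strongly_convex m f \<longleftrightarrow> (\<forall>x y. m / 2 * (norm (y - x))\<^sup>2 \<le> bregman f y x)"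
proof
  assume sc: "strongly_convex m f"
  show "\<forall>x y. m / 2 * (norm (y - x))\<^sup>2 \<le> bregman f y x"
  proof (intro allI)
    fix x y :: 'a
    define N where "N = (norm (x - y))\<^sup>2"
    define p where "p = (\<lambda>u. f (x + u *\<^sub>R (y - x)))"
    have "((\<lambda>u. x + u *\<^sub>R (y - x)) has_derivative (\<lambda>u. u *\<^sub>R (y - x))) (at 0)"
      by (auto intro!: derivative_eq_intros)
    moreover have "(f has_derivative (\<lambda>v. v \<bullet> gradient f x)) (at (x + 0 *\<^sub>R (y - x)))"
      using GDERIV_gradient[OF diff, of x] by (simp add: gderiv_def)
    ultimately have "(p has_derivative (\<lambda>u. (u *\<^sub>R (y - x)) \<bullet> gradient f x)) (at 0)"
      unfolding p_def by (rule has_derivative_compose)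
    then have "(p has_field_derivative (gradient f x \<bullet> (y - x))) (at 0)"
      unfolding has_field_derivative_def
      by (rule has_derivative_eq_rhs) (simp add: fun_eq_iff inner_commute mult.commute)
    then have "((\<lambda>u. (p u - p 0) / u) \<longlongrightarrow> gradient f x \<bullet> (y - x)) (at 0)"
      by (simp add: DERIV_def)
    then have lim: "((\<lambda>u. (p u - p 0) / u) \<longlongrightarrow> gradient f x \<bullet> (y - x)) (at_right 0)"
      by (rule filterlim_mono) (auto simp: at_le)
    have "((\<lambda>u::real. f y - f x - m / 2 * (1 - u) * N) \<longlongrightarrow> f y - f x - m / 2 * (1 - 0) * N) (at_right 0)"
      by (intro tendsto_intros)
    moreover have "\<forall>\<^sub>F u in at_right (0::real). (p u - p 0) / u \<le> f y - f x - m / 2 * (1 - u) * N"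
      unfolding eventually_at_right_field
    proof (intro exI[of _ 1] conjI allI impI)
      fix u :: real assume u: "0 < u" "u < 1"
      have "f ((1 - u) *\<^sub>R x + u *\<^sub>R y) \<le> (1 - u) * f x + u * f y - m / 2 * u * (1 - u) * N"
        using sc u unfolding strongly_convex_def N_def by force
      moreover have "(1 - u) *\<^sub>R x + u *\<^sub>R y = x + u *\<^sub>R (y - x)"
        by (simp add: algebra_simps)
      ultimately have "p u - p 0 \<le> (f y - f x - m / 2 * (1 - u) * N) * u"
        by (simp add: p_def algebra_simps)
      then show "(p u - p 0) / u \<le> f y - f x - m / 2 * (1 - u) * N"
        using u by (simp add: pos_divide_le_eq)
    qed simp
    ultimately have "gradient f x \<bullet> (y - x) \<le> f y - f x - m / 2 * (1 - 0) * N"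
      using tendsto_le[OF trivial_limit_at_right_real _ lim] by blast
    then show "m / 2 * (norm (y - x))\<^sup>2 \<le> bregman f y x"
      by (simp add: bregman_def N_def norm_minus_commute)
  qed
next
  assume br: "\<forall>x y. m / 2 * (norm (y - x))\<^sup>2 \<le> bregman f y x"
  show "strongly_convex m f"
    unfolding strongly_convex_def
  proof (intro allI ballI)
    fix x y :: 'a and u :: real assume u: "u \<in> {0..1}"
    define N where "N = (norm (x - y))\<^sup>2"
    define z where "z = (1 - u) *\<^sub>R x + u *\<^sub>R y"
    define G where "G = gradient f z \<bullet> (x - y)"
    have xz: "x - z = u *\<^sub>R (x - y)" and yz: "y - z = (- (1 - u)) *\<^sub>R (x - y)"
      by (simp_all add: z_def algebra_simps)
    have "m / 2 * (u\<^sup>2 * N) \<le> f x - f z - u * G"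
      using br[rule_format, of x z] unfolding bregman_def xz
      by (simp add: power_mult_distrib N_def G_def)
    then have 1: "(1 - u) * (m / 2 * (u\<^sup>2 * N)) \<le> (1 - u) * (f x - f z - u * G)"
      using u by (intro mult_left_mono) auto
    have "m / 2 * ((1 - u)\<^sup>2 * N) \<le> f y - f z + (1 - u) * G"
      using br[rule_format, of y z] unfolding bregman_def yz norm_scaleR inner_scaleR_right
      by (simp add: power_mult_distrib N_def G_def algebra_simps power2_commute)
    then have 2: "u * (m / 2 * ((1 - u)\<^sup>2 * N)) \<le> u * (f y - f z + (1 - u) * G)"
      using u by (intro mult_left_mono) auto
    have "(1 - u) * (m / 2 * (u\<^sup>2 * N)) + u * (m / 2 * ((1 - u)\<^sup>2 * N)) = m / 2 * u * (1 - u) * N"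
      by (simp add: field_simps power2_eq_square)
    moreover have "(1 - u) * (f x - f z - u * G) + u * (f y - f z + (1 - u) * G)
        = (1 - u) * f x + u * f y - f z"
      by (simp add: algebra_simps)
    ultimately show "f ((1 - u) *\<^sub>R x + u *\<^sub>R y)
        \<le> (1 - u) * f x + u * f y - m / 2 * u * (1 - u) * (norm (x - y))\<^sup>2"
      using 1 2 unfolding z_def[symmetric] N_def[symmetric] by linarith
  qed
qed

text \<open>Sequences are indexed by \<open>nat\<close>; rounds are \<open>1, \<dots>, T\<close>, and only these indices matter
  (plus index \<open>0\<close> for the starting point of a sequence of decisions).\<close>

definition admissible ::
  "real \<Rightarrow> nat \<Rightarrow> (nat \<Rightarrow> 'a::euclidean_space \<Rightarrow> real) \<Rightarrow> (nat \<Rightarrow> 'a) \<Rightarrow> bool" where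
  "admissible m T f v \<longleftrightarrow>
     (\<forall>t\<in>{1..T}. (\<forall>x. 0 \<le> f t x) \<and> strongly_convex m (f t) \<and> is_arg_min (f t) (\<lambda>_. True) (v t))"

definition total_cost ::
  "('a::euclidean_space \<Rightarrow> real) \<Rightarrow> nat \<Rightarrow> (nat \<Rightarrow> 'a \<Rightarrow> real) \<Rightarrow> (nat \<Rightarrow> 'a) \<Rightarrow> real" where
  "total_cost h T f x = (\<Sum>t=1..T. f t (x t) + bregman h (x t) (x (t - 1)))"

text \<open>The infimum over all offline sequences, which is the minimum whenever it is attained.\<close>

definition opt_cost ::
  "('a::euclidean_space \<Rightarrow> real) \<Rightarrow> nat \<Rightarrow> 'a \<Rightarrow> (nat \<Rightarrow> 'a \<Rightarrow> real) \<Rightarrow> real" where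
  "opt_cost h T x\<^sub>0 f = (INF x\<in>{x. x 0 = x\<^sub>0}. total_cost h T f x)"

text \<open>A deterministic online algorithm maps the starting point and the pairs (hitting cost,
  minimizer) revealed in rounds \<open>1, \<dots>, t\<close> to its decision in round \<open>t\<close>.\<close>

type_synonym 'a online_algorithm = "'a \<Rightarrow> (('a \<Rightarrow> real) \<times> 'a) list \<Rightarrow> 'a"

definition decisions ::
  "'a online_algorithm \<Rightarrow> 'a \<Rightarrow> (nat \<Rightarrow> 'a \<Rightarrow> real) \<Rightarrow> (nat \<Rightarrow> 'a) \<Rightarrow> nat \<Rightarrow> 'a" where
  "decisions alg x\<^sub>0 f v t =
     (if t = 0 then x\<^sub>0 else alg x\<^sub>0 (map (\<lambda>s. (f s, v s)) [1..<Suc t]))"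

text \<open>The regularizer \<open>g\<close> of round \<open>t\<close> may differ from instance to instance (so it may depend
  on everything revealed so far); only its constants \<open>a' t\<close> and \<open>b' t\<close> are fixed.\<close>

definition regularized_form ::
  "real \<Rightarrow> ('a::euclidean_space \<Rightarrow> real) \<Rightarrow> nat \<Rightarrow> (nat \<Rightarrow> real) \<Rightarrow> (nat \<Rightarrow> real) \<Rightarrow>
   'a online_algorithm \<Rightarrow> bool" where
  "regularized_form m h T a' b' alg \<longleftrightarrow>
     (\<forall>x\<^sub>0 f v. admissible m T f v \<longrightarrow>
        (\<forall>t\<in>{1..T}. \<exists>g. strongly_convex_smooth (a' t) (b' t) g \<and>
           is_arg_min
             (\<lambda>x. f t x + bregman h x (decisions alg x\<^sub>0 f v (t - 1)) + bregman g x (v t))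
             (\<lambda>_. True)
             (decisions alg x\<^sub>0 f v t)))"

definition competitive_ratio_le ::
  "real \<Rightarrow> ('a::euclidean_space \<Rightarrow> real) \<Rightarrow> nat \<Rightarrow> 'a online_algorithm \<Rightarrow> real \<Rightarrow> bool" where
  "competitive_ratio_le m h T alg \<rho> \<longleftrightarrow>
     (\<forall>x\<^sub>0 f v. admissible m T f v \<longrightarrow>
        total_cost h T f (decisions alg x\<^sub>0 f v) \<le> \<rho> * opt_cost h T x\<^sub>0 f)"

end

theory Submission
  imports Defs
begin

text \<open>Since \<open>x\<^sub>t\<close> minimizes an objective made of an \<open>m\<close>-strongly convex function and two Bregman
  divergences, it improves on any offline point \<open>y\<^sub>t\<close> by at least the slack
  \<open>m/2 \<parallel>y\<^sub>t - x\<^sub>t\<parallel>\<^sup>2 + D\<^sub>h(y\<^sub>t\<parallel>x\<^sub>t) + D\<^sub>g(y\<^sub>t\<parallel>x\<^sub>t)\<close>. The regularizer paid by \<open>y\<^sub>t\<close> is charged to its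
  hitting cost, because \<open>f\<^sub>t(y\<^sub>t) \<ge> m/2 \<parallel>y\<^sub>t - v\<^sub>t\<parallel>\<^sup>2\<close>. By the three-point identity, moving the
  potential from \<open>D\<^sub>h(y\<^sub>t\<parallel>x\<^sub>t\<^sub>-\<^sub>1)\<close> to \<open>D\<^sub>h(y\<^sub>t\<^sub>-\<^sub>1\<parallel>x\<^sub>t\<^sub>-\<^sub>1)\<close> costs the offline switching cost plus an
  inner product; Young's inequality splits the latter into a part absorbed by the quadratic slack
  left over from round \<open>t - 1\<close> and a multiple of the offline switching cost.\<close>

lemma bregman_three_point:
  "bregman h z x = bregman h y x + bregman h z y + (gradient h y - gradient h x) \<bullet> (z - y)"
  by (simp add: bregman_def inner_diff)

lemma bregman_nonneg:
  assumes "strongly_convex_smooth a b h" and "0 \<le> a"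
  shows "0 \<le> bregman h y x"
proof -
  have "0 \<le> a / 2 * (norm (y - x))\<^sup>2" using assms(2) by simp
  also have "\<dots> \<le> bregman h y x" using assms(1) by (simp add: strongly_convex_smooth_def)
  finally show ?thesis .
qed

text \<open>With \<open>w\<close> the gradient difference, smoothness makes the step lower the
  divergence by at least \<open>(norm w)\<^sup>2 / (2 * b)\<close>. It stays nonnegative, so
  \<open>bregman h y x\<close> is at least this, and at most
  \<open>b / 2 * (norm (y - x))\<^sup>2\<close>.\<close>

lemma gradient_lipschitz:
  assumes h: "strongly_convex_smooth a b h" and a: "0 \<le> a" and b: "0 < b"
  shows "norm (gradient h y - gradient h x) \<le> b * norm (y - x)"
proof -
  define w where "w = gradient h y - gradient h x"
  \<comment> \<open>a gradient step from \<open>y\<close> on \<open>bregman h _ x\<close>, whose minimum is \<open>0\<close>\<close>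
  define z where "z = y - (1 / b) *\<^sub>R w"
  have zy: "z - y = - ((1 / b) *\<^sub>R w)" by (simp add: z_def)
  have "bregman h z y \<le> b / 2 * (norm (z - y))\<^sup>2" and yx: "bregman h y x \<le> b / 2 * (norm (y - x))\<^sup>2"
    using h by (auto simp: strongly_convex_smooth_def)
  then have "bregman h z y \<le> (norm w)\<^sup>2 / (2 * b)"
    using b by (simp add: zy power_divide power2_eq_square)
  moreover have "w \<bullet> (z - y) = - (norm w)\<^sup>2 / b"
    by (simp add: zy power2_norm_eq_inner)
  moreover have "0 \<le> bregman h y x + bregman h z y + w \<bullet> (z - y)"
    using bregman_nonneg[OF h a, of z x] bregman_three_point[of h z x y] by (simp add: w_def)
  ultimately have "(norm w)\<^sup>2 / b \<le> (norm w)\<^sup>2 / (2 * b) + b / 2 * (norm (y - x))\<^sup>2"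
    using yx by linarith
  then have "(norm w)\<^sup>2 \<le> (b * norm (y - x))\<^sup>2"
    using b by (simp add: field_simps power2_eq_square)
  then show ?thesis
    unfolding w_def by (rule power2_le_imp_le) (use b in simp)
qed

text \<open>The first-order optimality condition, for a strongly convex function that need not be
  differentiable plus a perturbation with at most quadratic remainder.\<close>

lemma strongly_convex_first_order:
  fixes f :: "'a::euclidean_space \<Rightarrow> real"
  assumes sc: "strongly_convex m f"
    and min: "\<And>z. f x \<le> f z + w \<bullet> (z - x) + C * (norm (z - x))\<^sup>2"
  shows "f x + m / 2 * (norm (y - x))\<^sup>2 \<le> f y + w \<bullet> (y - x)"
proof -
  define N where "N = (norm (y - x))\<^sup>2"
  define K where "K = m / 2 * N"
  \<comment> \<open>\<open>A\<close> is the slack of the claim. Minimality is tested at the point a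
    fraction \<open>u\<close> of the way from \<open>x\<close> to \<open>y\<close>; after division
    by \<open>u\<close> the second-order terms are \<open>O(u)\<close> and vanish as
    \<open>u\<close> tends to 0.\<close>
  define A where "A = f y - f x + w \<bullet> (y - x) - K"
  have "0 \<le> A + (K + C * N) * u" if u: "0 < u" "u < 1" for u :: real
  proof -
    define z where "z = (1 - u) *\<^sub>R x + u *\<^sub>R y"
    have zx: "z - x = u *\<^sub>R (y - x)" by (simp add: z_def algebra_simps)
    have "f z \<le> (1 - u) * f x + u * f y - m / 2 * u * (1 - u) * (norm (x - y))\<^sup>2"
      using sc u by (simp add: strongly_convex_def z_def)
    also have "\<dots> = (1 - u) * f x + u * f y - K * u * (1 - u)"
      by (simp add: K_def N_def norm_minus_commute)
    finally have "f z \<le> (1 - u) * f x + u * f y - K * u * (1 - u)" .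
    moreover have "f x \<le> f z + u * (w \<bullet> (y - x)) + C * (u\<^sup>2 * N)"
      using min[of z] by (simp add: zx power_mult_distrib N_def)
    ultimately have "0 \<le> u * (A + (K + C * N) * u)"
      by (simp add: A_def algebra_simps power2_eq_square)
    then show ?thesis using u by (simp add: zero_le_mult_iff)
  qed
  then have ev: "\<forall>\<^sub>F u in at_right 0. 0 \<le> A + (K + C * N) * u"
    unfolding eventually_at_right_field by (intro exI[of _ 1]) auto
  have "((\<lambda>u. A + (K + C * N) * u) \<longlongrightarrow> A + (K + C * N) * 0) (at_right 0)"
    by (intro tendsto_intros)
  then have "0 \<le> A"
    using tendsto_lowerbound[OF _ ev] by simp
  then show ?thesis by (simp add: A_def K_def N_def)
qed

lemma regularized_minimizer_improves:
  fixes f h g :: "'a::euclidean_space \<Rightarrow> real"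
  assumes sc: "strongly_convex m f"
    and h: "strongly_convex_smooth \<alpha> \<beta> h"
    and g: "strongly_convex_smooth a b g" "0 \<le> a"
    and x: "is_arg_min (\<lambda>x. f x + bregman h x p + bregman g x v) (\<lambda>_. True) x"
  shows "f x + bregman h x p + bregman h y x + (m + a) / 2 * (norm (y - x))\<^sup>2
           \<le> f y + bregman h y p + b / 2 * (norm (y - v))\<^sup>2"
proof -
  define w where "w = gradient h x - gradient h p + (gradient g x - gradient g v)"
  \<comment> \<open>Recentering both divergences at \<open>x\<close> leaves a linear term and
    remainders that smoothness bounds quadratically, as the first-order condition requires.\<close>
  have expand: "bregman h z p + bregman g z v
      = bregman h x p + bregman g x v + bregman h z x + bregman g z x + w \<bullet> (z - x)" for z
    using bregman_three_point[of h z p x] bregman_three_point[of g z v x]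
    by (simp add: w_def inner_add_left)
  have "f x \<le> f z + w \<bullet> (z - x) + (\<beta> / 2 + b / 2) * (norm (z - x))\<^sup>2" for z
  proof -
    have "f x + bregman h x p + bregman g x v \<le> f z + bregman h z p + bregman g z v"
      using x by (auto simp: is_arg_min_def not_less)
    moreover have "bregman h z x \<le> \<beta> / 2 * (norm (z - x))\<^sup>2" "bregman g z x \<le> b / 2 * (norm (z - x))\<^sup>2"
      using h g by (auto simp: strongly_convex_smooth_def)
    ultimately show ?thesis using expand[of z] unfolding distrib_right by linarith
  qed
  from strongly_convex_first_order[OF sc this]
  have "f x + m / 2 * (norm (y - x))\<^sup>2 \<le> f y + w \<bullet> (y - x)" .
  moreover have "a / 2 * (norm (y - x))\<^sup>2 \<le> bregman g y x" "bregman g y v \<le> b / 2 * (norm (y - v))\<^sup>2"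
    using g by (auto simp: strongly_convex_smooth_def)
  moreover have "(m + a) / 2 * (norm (y - x))\<^sup>2 = m / 2 * (norm (y - x))\<^sup>2 + a / 2 * (norm (y - x))\<^sup>2"
    by (simp add: algebra_simps add_divide_distrib)
  ultimately show ?thesis
    using expand[of y] bregman_nonneg[OF g, of x v] by linarith
qed

text \<open>In the factor \<open>\<beta>\<^sup>2 / \<alpha>\<close>, \<open>\<beta>\<close> is the
  Lipschitz constant of the gradient, and \<open>\<alpha>\<close> converts
  \<open>(norm (y - q))\<^sup>2\<close> back into a divergence.\<close>

lemma bregman_change_point:
  fixes h :: "'a::euclidean_space \<Rightarrow> real"
  assumes h: "strongly_convex_smooth \<alpha> \<beta> h" and "0 < \<alpha>" "\<alpha> \<le> \<beta>" and L: "0 < L"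
  shows "bregman h y p \<le> (1 + (\<beta>\<^sup>2 / \<alpha>) / L) * bregman h y q + bregman h q p + L / 2 * (norm (q - p))\<^sup>2"
proof -
  define r s where "r = norm (q - p)" and "s = norm (y - q)"
  have "norm (gradient h q - gradient h p) \<le> \<beta> * r"
    using gradient_lipschitz[OF h] assms(2,3) by (simp add: r_def)
  then have "norm (gradient h q - gradient h p) * s \<le> (\<beta> * r) * s"
    by (rule mult_right_mono) (simp add: s_def)
  then have "(gradient h q - gradient h p) \<bullet> (y - q) \<le> (\<beta> * r) * s"
    using norm_cauchy_schwarz[of "gradient h q - gradient h p" "y - q"] by (simp add: s_def)
  moreover have "(\<beta> * r) * s \<le> L / 2 * r\<^sup>2 + \<beta>\<^sup>2 / (2 * L) * s\<^sup>2"
  proof -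
    have "0 \<le> (L * r - \<beta> * s)\<^sup>2 / (2 * L)" using L by simp
    also have "\<dots> = L / 2 * r\<^sup>2 + \<beta>\<^sup>2 / (2 * L) * s\<^sup>2 - (\<beta> * r) * s"
      using L by (simp add: field_simps power2_eq_square)
    finally show ?thesis by simp
  qed
  moreover have "\<beta>\<^sup>2 / (2 * L) * s\<^sup>2 \<le> (\<beta>\<^sup>2 / \<alpha>) / L * bregman h y q"
  proof -
    have "\<beta>\<^sup>2 / (2 * L) * s\<^sup>2 = (\<beta>\<^sup>2 / \<alpha>) / L * (\<alpha> / 2 * s\<^sup>2)"
      using assms(2) by simp
    also have "\<dots> \<le> (\<beta>\<^sup>2 / \<alpha>) / L * bregman h y q"
      using h assms(2) L unfolding s_def
      by (intro mult_left_mono) (auto simp: strongly_convex_smooth_def)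
    finally show ?thesis .
  qed
  ultimately show ?thesis
    using bregman_three_point[of h y p q] by (simp add: r_def distrib_right)
qed

text \<open>Here \<open>p\<close> and \<open>q\<close> are the previous online and offline points.
  The two lower bounds on \<open>\<rho>\<close> pay for the regularizer and for the change of point,
  respectively.\<close>

lemma one_round_bound:
  fixes f h g :: "'a::euclidean_space \<Rightarrow> real"
  assumes f: "strongly_convex m f" "\<And>x. 0 \<le> f x" "is_arg_min f (\<lambda>_. True) v" and "0 < m"
    and h: "strongly_convex_smooth \<alpha> \<beta> h" "0 < \<alpha>" "\<alpha> \<le> \<beta>"
    and g: "strongly_convex_smooth a b g" "0 \<le> a" "a \<le> b"
    and x: "is_arg_min (\<lambda>x. f x + bregman h x p + bregman g x v) (\<lambda>_. True) x"
    and L: "0 < L"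
    and \<rho>: "1 + b / m \<le> \<rho>" "1 + (\<beta>\<^sup>2 / \<alpha>) / L \<le> \<rho>"
  shows "f x + bregman h x p + bregman h y x + (m + a) / 2 * (norm (y - x))\<^sup>2
           \<le> \<rho> * (f y + bregman h y q) + bregman h q p + L / 2 * (norm (q - p))\<^sup>2"
proof -
  have "f v + m / 2 * (norm (y - v))\<^sup>2 \<le> f y + 0 \<bullet> (y - v)"
    using f(3) by (intro strongly_convex_first_order[OF f(1), where C = 0])
      (auto simp: is_arg_min_def not_less)
  then have "m / 2 * (norm (y - v))\<^sup>2 \<le> f y"
    using f(2)[of v] by simp
  then have "b / m * (m / 2 * (norm (y - v))\<^sup>2) \<le> b / m * f y"
    using g(2,3) \<open>0 < m\<close> by (intro mult_left_mono) auto
  then have "f y + b / 2 * (norm (y - v))\<^sup>2 \<le> (1 + b / m) * f y"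
    using \<open>0 < m\<close> by (simp add: distrib_right)
  also have "\<dots> \<le> \<rho> * f y"
    using \<rho>(1) f(2) by (rule mult_right_mono)
  finally have 1: "f y + b / 2 * (norm (y - v))\<^sup>2 \<le> \<rho> * f y" .
  have "(1 + (\<beta>\<^sup>2 / \<alpha>) / L) * bregman h y q \<le> \<rho> * bregman h y q"
    using \<rho>(2) bregman_nonneg[OF h(1)] h(2) by (intro mult_right_mono) auto
  then show ?thesis
    using 1 bregman_change_point[OF h L, of y p q]
      regularized_minimizer_improves[OF f(1) h(1) g(1,2) x, of y]
    unfolding distrib_left by linarith
qed

theorem theorem3p10:
  fixes m \<alpha> \<beta> :: real and T :: nat
    and h :: "real ^ 'd \<Rightarrow> real"
    and \<alpha>' \<beta>' :: "nat \<Rightarrow> real"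
    and ALG :: "(real ^ 'd) online_algorithm"
  assumes "m > 0" and "0 < \<alpha>" and "\<alpha> \<le> \<beta>" and "T \<ge> 2"
    and "strongly_convex_smooth \<alpha> \<beta> h"
    and "\<And>t. t \<in> {1..T} \<Longrightarrow> 0 \<le> \<alpha>' t \<and> \<alpha>' t \<le> \<beta>' t"
    and "regularized_form m h T \<alpha>' \<beta>' ALG"
  shows "competitive_ratio_le m h T ALG
    (1 + max ((MAX t\<in>{1..T}. \<beta>' t) / m)
             ((\<beta>\<^sup>2 / \<alpha>) / ((MIN t\<in>{2..T}. \<alpha>' (t - 1)) + m)))"
proof -
  define L where "L = (MIN t\<in>{2..T}. \<alpha>' (t - 1)) + m"
  define \<rho> where "\<rho> = 1 + max ((MAX t\<in>{1..T}. \<beta>' t) / m) ((\<beta>\<^sup>2 / \<alpha>) / L)"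
  \<comment> \<open>The shifted minimum ranges over \<open>\<alpha>' 1\<close> to
    \<open>\<alpha>' (T - 1)\<close>, hence the restriction \<open>t < T\<close>.\<close>
  have L_le: "L \<le> m + \<alpha>' t" if "1 \<le> t" "t < T" for t
  proof -
    have "(MIN t\<in>{2..T}. \<alpha>' (t - 1)) \<le> \<alpha>' (Suc t - 1)"
    proof (rule Min_le)
      show "\<alpha>' (Suc t - 1) \<in> (\<lambda>t. \<alpha>' (t - 1)) ` {2..T}"
        using that by (intro imageI) simp
    qed simp
    then have "(MIN t\<in>{2..T}. \<alpha>' (t - 1)) \<le> \<alpha>' t"
      unfolding diff_Suc_1 .
    then show ?thesis unfolding L_def by linarith
  qed
  have "0 \<le> (MIN t\<in>{2..T}. \<alpha>' (t - 1))"
  proof (rule Min.boundedI)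
    fix a assume "a \<in> (\<lambda>t. \<alpha>' (t - 1)) ` {2..T}"
    then obtain t where "t \<in> {2..T}" and a: "a = \<alpha>' (t - 1)" by blast
    then have "t - 1 \<in> {1..T}" by auto
    from assms(6)[OF this] show "0 \<le> a" unfolding a ..
  qed (use assms(4) in simp_all)
  then have L: "0 < L" using \<open>m > 0\<close> by (simp add: L_def)
  have \<rho>1: "1 + \<beta>' t / m \<le> \<rho>" if "t \<in> {1..T}" for t
  proof -
    have "\<beta>' t \<le> (MAX t\<in>{1..T}. \<beta>' t)" using that by (intro Max_ge imageI) simp_all
    then have "\<beta>' t / m \<le> (MAX t\<in>{1..T}. \<beta>' t) / m"
      using \<open>m > 0\<close> by (simp add: divide_right_mono)
    then show ?thesis
      unfolding \<rho>_def by (intro add_left_mono max.coboundedI1)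
  qed
  have \<rho>2: "1 + (\<beta>\<^sup>2 / \<alpha>) / L \<le> \<rho>"
    unfolding \<rho>_def by (intro add_left_mono max.cobounded2)
  moreover have "0 \<le> (\<beta>\<^sup>2 / \<alpha>) / L" using L assms(2) by simp
  ultimately have \<rho>: "0 < \<rho>" by linarith
  have "competitive_ratio_le m h T ALG \<rho>"
    unfolding competitive_ratio_le_def
  proof (intro allI impI)
    fix x\<^sub>0 :: "real ^ 'd" and f :: "nat \<Rightarrow> real ^ 'd \<Rightarrow> real" and v :: "nat \<Rightarrow> real ^ 'd"
    assume adm: "admissible m T f v"
    define x where "x = decisions ALG x\<^sub>0 f v"
    \<comment> \<open>After the last round nothing has to be absorbed; \<open>\<alpha>' T\<close> does not enter \<open>L\<close>.\<close>
    define c where "c n = (if n < T then L else 0)" for n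
    have bound: "total_cost h T f x \<le> \<rho> * total_cost h T f y" if y0: "y 0 = x\<^sub>0" for y
    proof -
      \<comment> \<open>Amortized invariant: the potential is the divergence plus the slack saved
        for the next round. It vanishes at \<open>n = 0\<close>, where both sequences start at
        \<open>x\<^sub>0\<close>.\<close>
      have "total_cost h n f x + bregman h (y n) (x n) + c n / 2 * (norm (y n - x n))\<^sup>2
          \<le> \<rho> * total_cost h n f y" if "n \<le> T" for n
        using that
      proof (induction n)
        case 0
        then show ?case
          using y0 by (simp add: total_cost_def x_def decisions_def bregman_def)
      next
        case (Suc n)
        let ?t = "Suc n"
        have t: "?t \<in> {1..T}" using Suc.prems by simp
        obtain g where g: "strongly_convex_smooth (\<alpha>' ?t) (\<beta>' ?t) g"
          "is_arg_min (\<lambda>z. f ?t z + bregman h z (x n) + bregman g z (v ?t)) (\<lambda>_. True) (x ?t)"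
          using assms(7) adm t unfolding regularized_form_def x_def by fastforce
        have f: "strongly_convex m (f ?t)" "\<And>z. 0 \<le> f ?t z" "is_arg_min (f ?t) (\<lambda>_. True) (v ?t)"
          using adm t by (auto simp: admissible_def)
        have "f ?t (x ?t) + bregman h (x ?t) (x n) + bregman h (y ?t) (x ?t)
              + (m + \<alpha>' ?t) / 2 * (norm (y ?t - x ?t))\<^sup>2
            \<le> \<rho> * (f ?t (y ?t) + bregman h (y ?t) (y n)) + bregman h (y n) (x n)
              + L / 2 * (norm (y n - x n))\<^sup>2"
          by (rule one_round_bound[OF f assms(1,5,2,3) g(1) _ _ g(2) L \<rho>1[OF t] \<rho>2])
            (use assms(6)[OF t] in auto)
        moreover have "c ?t / 2 * (norm (y ?t - x ?t))\<^sup>2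
            \<le> (m + \<alpha>' ?t) / 2 * (norm (y ?t - x ?t))\<^sup>2"
          using L_le[of ?t] assms(1) assms(6)[OF t]
          by (intro mult_right_mono divide_right_mono) (auto simp: c_def)
        moreover have "c n = L" using Suc.prems by (simp add: c_def)
        ultimately show ?case
          using Suc.IH Suc.prems by (simp add: total_cost_def distrib_left)
      qed
      from this[of T] show ?thesis
        using bregman_nonneg[OF assms(5), of "y T" "x T"] assms(2) by (simp add: c_def)
    qed
    \<comment> \<open>Dividing by \<open>\<rho>\<close> gives a lower bound for every offline cost,
      hence for the infimum, whether or not it is attained.\<close>
    have "total_cost h T f x / \<rho> \<le> opt_cost h T x\<^sub>0 f"
      unfolding opt_cost_def
    proof (rule cINF_greatest)
      show "{y. y 0 = x\<^sub>0} \<noteq> {}" by (auto intro: exI[of _ "\<lambda>_. x\<^sub>0"])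
    qed (use bound \<rho> in \<open>simp add: pos_divide_le_eq mult.commute\<close>)
    then show "total_cost h T f (decisions ALG x\<^sub>0 f v) \<le> \<rho> * opt_cost h T x\<^sub>0 f"
      using \<rho> by (simp add: pos_divide_le_eq mult.commute x_def)
  qed
  then show ?thesis
    unfolding \<rho>_def L_def .
qed

end
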